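(* Let $n\ge 1$ and let $r<\alpha<\beta<s$ be four arbitrary finite real numbers. Then there is a continuous bounded radial function $\varphi(x)=\varphi(|x|)$, $x\in\mathbb{R}^n$, such that $\varphi$ and the convolution solution $u(x,t)$ of the heat equation with initial data $\varphi$ satisfy $$\liminf_{\tau\to\infty}\varphi(\tau)=r<\liminf_{t\to\infty}u(0,t)=\alpha<\limsup_{t\to\infty}u(0,t)=\beta<\limsup_{\tau\to\infty}\varphi(\tau)=s.$$ More precisely, one can choose $$\varphi(\tau)=\left[C_1\sin\left(m\log(\tau+1)\right)+C_2\right]+\psi(\tau),\qquad \tau\in[0,\infty),$$ for some suitable constants $m>0$, $C_1>0$, $C_2\in\mathbb{R}$ depending on $r,\alpha,\beta,s$ and some $2\pi$-periodic continuous nonzero function $\psi(\tau)$ satisfying $\frac{1}{2\pi}\int_0^{2\pi}\psi(\tau)\,d\tau=0$.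
   Context: The convolution solution of $u_t=\Delta u$ on $\mathbb{R}^n\times(0,\infty)$, $u(x,0)=\varphi(x)$, with $\varphi$ continuous and bounded on $\mathbb{R}^n$, is $u(x,t)=\frac{1}{(4\pi t)^{n/2}}\int_{\mathbb{R}^n}e^{-|x-y|^2/(4t)}\varphi(y)\,dy$. A radial function is written $\varphi(x)=\varphi(\tau)$ with $\tau=|x|\in[0,\infty)$. *)

theory Defs
  imports "HOL-Analysis.Analysis"
begin

text \<open>
  The convolution of \<open>\<phi>\<close> with the heat kernel on \<open>\<real>\<^sup>n\<close>, where \<open>n = CARD('n)\<close>. The formula is
  meaningful for \<open>t > 0\<close> and \<open>\<phi>\<close> continuous and bounded, in which case the integrand is
  Lebesgue integrable.
\<close>

definition heat_convolution :: "(real ^ 'n \<Rightarrow> real) \<Rightarrow> real ^ 'n \<Rightarrow> real \<Rightarrow> real" where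
  "heat_convolution \<phi> x t =
     1 / (4 * pi * t) powr (real CARD('n) / 2) *
     (LINT y|lborel. exp (- (norm (x - y))\<^sup>2 / (4 * t)) * \<phi> y)"

end

theory Submission
  imports Defs "HOL-Probability.Distributions" "HOL-Real_Asymp.Real_Asymp"
begin

text \<open>
  Polar coordinates turn the solution at the origin into
  \<open>u(0,t) = E f(2 \<surd>t |Z|)\<close>, where \<open>Z\<close> has density \<open>\<pi>\<^bsup>-n/2\<^esup> exp (-|z|\<^sup>2)\<close>.
  The periodic part averages out as \<open>t \<rightarrow> \<infinity>\<close> (Riemann-Lebesgue), while the logarithmic
  part survives: up to \<open>o(1)\<close>, \<open>sin (m log (2 \<surd>t |Z|))\<close> averages to a sine of
  \<open>m log (2 \<surd>t)\<close> with amplitude \<open>\<rho>(m) = |E exp (i m log |Z|)|\<close>. Hence \<open>u(0,t)\<close> oscillates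
  between \<open>C\<^sub>2 \<plusminus> C\<^sub>1 \<rho>(m)\<close>, whereas the initial datum itself oscillates between
  \<open>C\<^sub>2 - C\<^sub>1 + min \<psi>\<close> and \<open>C\<^sub>2 + C\<^sub>1 + max \<psi>\<close>. Since \<open>\<rho>(m) \<rightarrow> 1\<close> as \<open>m \<rightarrow> 0\<close>, for small \<open>m\<close> the
  constant \<open>C\<^sub>1 = (\<beta> - \<alpha>) / (2 \<rho>(m))\<close> leaves room for a zero-mean \<open>\<psi>\<close> with the prescribed
  maximum \<open>s - C\<^sub>2 - C\<^sub>1 > 0\<close> and minimum \<open>r - C\<^sub>2 + C\<^sub>1 < 0\<close>.
\<close>

subsection \<open>Radial integrals and the heat kernel\<close>

text \<open>The density of \<open>|Z|\<close>, where \<open>Z\<close> has density \<open>\<pi>\<^bsup>-n/2\<^esup> exp (-|z|\<^sup>2)\<close> on \<open>\<real>\<^sup>n\<close>.\<close>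

definition radial_gauss_density :: "nat \<Rightarrow> real \<Rightarrow> real" where
  "radial_gauss_density n x = indicator {0..} x * (2 / Gamma (real n / 2) * (exp (- x\<^sup>2) * x ^ (n - 1)))"

text \<open>Polar coordinates without surface measure: both sides give the half-line up to
  \<open>a\<close> the volume of a ball of radius \<open>max 0 a\<close>, because the density is the
  derivative of the ball volume in the radius. Half-lines are an intersection-stable generator, so
  the measures agree.\<close>

lemma distr_norm_lborel:
  "distr lborel borel (norm :: 'a::euclidean_space \<Rightarrow> real) =
     density lborel (\<lambda>x. ennreal (unit_ball_vol DIM('a) * (DIM('a) * x ^ (DIM('a) - 1))) * indicator {0..} x)"
  (is "?D = ?E")
proof (rule measure_eqI_generator_eq[where \<Omega> = UNIV and E = "range (\<lambda>a::real. {..a})" and A = "\<lambda>i. {..real i}"])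
  have *: "emeasure ?D {..a} = ennreal (unit_ball_vol DIM('a) * max 0 a ^ DIM('a))" for a
  proof -
    have "emeasure ?D {..a} = emeasure lborel (cball (0::'a) a)"
      by (subst emeasure_distr) (auto intro!: arg_cong2[where f = emeasure] simp: dist_norm)
    then show ?thesis
      by (cases "a \<ge> 0") (auto simp: emeasure_cball max_def)
  qed
  show "emeasure ?D X = emeasure ?E X" if "X \<in> range (\<lambda>a::real. {..a})" for X
  proof -
    from that obtain a where X: "X = {..a}" by auto
    have "emeasure ?E X = (\<integral>\<^sup>+ x. ennreal (unit_ball_vol DIM('a) * (DIM('a) * x ^ (DIM('a) - 1))) * indicator {0..a} x \<partial>lborel)"
      unfolding X by (subst emeasure_density) (auto intro!: nn_integral_cong split: split_indicator)
    also have "\<dots> = ennreal (unit_ball_vol DIM('a) * max 0 a ^ DIM('a))"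
    proof (cases "a \<ge> 0")
      case True
      have "((\<lambda>x. unit_ball_vol DIM('a) * x ^ DIM('a)) has_real_derivative
          unit_ball_vol DIM('a) * (DIM('a) * x ^ (DIM('a) - 1))) (at x)" for x :: real
        by (auto intro!: derivative_eq_intros)
      then show ?thesis using True
        by (subst nn_integral_FTC_Icc[where F = "\<lambda>x. unit_ball_vol DIM('a) * x ^ DIM('a)"])
           (simp_all add: max_def has_field_derivative_at_within)
    qed (simp add: max_def)
    finally show ?thesis unfolding X * ..
  qed
  show "Int_stable (range (\<lambda>a::real. {..a}))"
    by (auto simp: Int_stable_def)
  show "sets ?D = sigma_sets UNIV (range (\<lambda>a::real. {..a}))"
    "sets ?E = sigma_sets UNIV (range (\<lambda>a::real. {..a}))"
    by (simp_all add: borel_eq_atMost)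
  show "(\<Union>i. {..real i}) = UNIV" by (auto simp: real_arch_simple)
  show "emeasure ?D {..real i} \<noteq> \<infinity>" for i by (simp add: *)
qed auto

lemma integral_lborel_radial:
  fixes g :: "real \<Rightarrow> real"
  assumes [measurable]: "g \<in> borel_measurable borel"
  shows "(LINT y|lborel. g (norm (y::'a::euclidean_space))) =
    (LINT x|lborel. indicator {0..} x * (unit_ball_vol DIM('a) * (DIM('a) * x ^ (DIM('a) - 1))) * g x)"
proof -
  have "(LINT y|lborel. g (norm (y::'a))) = (LINT x|distr lborel borel (norm :: 'a \<Rightarrow> real). g x)"
    by (subst integral_distr) auto
  also have "\<dots> = (LINT x|density lborel (\<lambda>x. ennreal (indicator {0..} x * (unit_ball_vol DIM('a) * (DIM('a) * x ^ (DIM('a) - 1))))). g x)"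
    unfolding distr_norm_lborel
    by (intro arg_cong2[where f = "integral\<^sup>L"] refl density_cong) (auto split: split_indicator)
  also have "\<dots> = (LINT x|lborel. indicator {0..} x * (unit_ball_vol DIM('a) * (DIM('a) * x ^ (DIM('a) - 1))) * g x)"
    by (subst integral_density) (simp_all add: indicator_def)
  finally show ?thesis .
qed

text \<open>Brings the half-integer Gamma value into the form in which the even Gaussian moments are
  stated, as odd dimensions require.\<close>

lemma Gamma_half_odd: "Gamma (real (2 * k + 1) / 2) = sqrt pi * (fact (2 * k) / (2 ^ (2 * k) * fact k))"
proof -
  have "Gamma (1/2 + real k) = pochhammer (1/2) k * Gamma (1/2)"
    by (subst pochhammer_Gamma) (auto simp: Gamma_eq_zero_iff)
  also have "\<dots> = sqrt pi * (fact (2 * k) / (2 ^ (2 * k) * fact k))"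
    by (simp add: fact_double Gamma_one_half_real)
  also have "1/2 + real k = real (2 * k + 1) / 2" by simp
  finally show ?thesis .
qed

text \<open>The half-line moment of order \<open>n - 1\<close> of \<open>exp (- x\<^sup>2)\<close>
  is \<open>Gamma (n / 2) / 2\<close>. Its closed form depends on the parity of the exponent, hence
  the case split; even \<open>n\<close> means an odd moment.\<close>

lemma has_bochner_integral_radial_gauss_density:
  assumes "n > 0"
  shows "has_bochner_integral lborel (radial_gauss_density n) 1"
proof -
  have "has_bochner_integral lborel (\<lambda>x::real. indicator {0..} x *\<^sub>R (exp (-x\<^sup>2)*x^(n - 1))) (Gamma (real n / 2) / 2)"
  proof (cases "even n")
    case True
    then obtain k where n: "n = 2 * (k + 1)" using assms
      by (metis Suc_eq_plus1 dvd_def gr0_conv_Suc mult_is_0 not_gr0)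
    have "real n / 2 = 1 + real k" by (simp add: n)
    then have "Gamma (real n / 2) = fact k" by (simp only: Gamma_fact)
    then show ?thesis using gaussian_moment_odd_pos[of k] by (simp add: n)
  next
    case False
    then obtain k where n: "n = 2 * k + 1" by (elim oddE)
    show ?thesis using gaussian_moment_even_pos[of k] unfolding n Gamma_half_odd by (simp add: mult_ac)
  qed
  from has_bochner_integral_mult_right[OF this, of "2 / Gamma (real n / 2)"]
  have "has_bochner_integral lborel (\<lambda>x::real. 2 / Gamma (real n / 2) * (indicator {0..} x *\<^sub>R (exp (-x\<^sup>2)*x^(n - 1)))) 1"
    using assms Gamma_real_pos[of "real n / 2"] by (cases "Gamma (real n / 2) = 0") simp_all
  moreover have "radial_gauss_density n = (\<lambda>x::real. 2 / Gamma (real n / 2) * (indicator {0..} x *\<^sub>R (exp (-x\<^sup>2)*x^(n - 1))))"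
    by (auto simp: radial_gauss_density_def fun_eq_iff)
  ultimately show ?thesis by simp
qed

lemma borel_measurable_radial_gauss_density [measurable]: "radial_gauss_density n \<in> borel_measurable borel"
  unfolding radial_gauss_density_def by measurable

lemma radial_gauss_density_nonneg: "n > 0 \<Longrightarrow> radial_gauss_density n x \<ge> 0"
  unfolding radial_gauss_density_def by (auto split: split_indicator intro!: mult_nonneg_nonneg)

lemma integral_radial_gauss_density: "n > 0 \<Longrightarrow> (LINT x|lborel. radial_gauss_density n x) = 1"
  by (rule has_bochner_integral_integral_eq[OF has_bochner_integral_radial_gauss_density])

lemma integrable_radial_gauss_density: "n > 0 \<Longrightarrow> integrable lborel (radial_gauss_density n)"
  using has_bochner_integral_radial_gauss_density by (auto simp: has_bochner_integral_iff)

lemma integrable_radial_gauss_density_mult: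
  fixes g :: "real \<Rightarrow> real"
  assumes "n > 0" and [measurable]: "g \<in> borel_measurable borel" and g: "\<And>x. \<bar>g x\<bar> \<le> B"
  shows "integrable lborel (\<lambda>x. radial_gauss_density n x * g x)"
proof (rule Bochner_Integration.integrable_bound)
  show "integrable lborel (\<lambda>x. radial_gauss_density n x * B)"
    using integrable_radial_gauss_density[OF assms(1)] by simp
  have "\<bar>g x\<bar> \<le> \<bar>B\<bar>" for x using g[of x] by linarith
  then show "AE x in lborel. norm (radial_gauss_density n x * g x) \<le> norm (radial_gauss_density n x * B)"
    by (auto simp: abs_mult intro!: mult_left_mono)
qed auto

text \<open>After passing to the radial integral, the substitution by the factor
  \<open>2 * sqrt t\<close> removes \<open>t\<close> from the Gaussian and moves it into the
  argument of \<open>f\<close>.\<close>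

lemma heat_convolution_radial:
  fixes f :: "real \<Rightarrow> real"
  assumes [measurable]: "f \<in> borel_measurable borel" and t: "t > 0"
  shows "heat_convolution (\<lambda>x :: real ^ 'n. f (norm x)) 0 t =
    (LINT x|lborel. radial_gauss_density CARD('n) x * f (2 * sqrt t * x))"
proof -
  define n where "n = CARD('n)"
  have n: "n > 0" "DIM(real ^ 'n) = n" by (simp_all add: n_def)
  define c where "c = 1 / (4 * pi * t) powr (real n / 2)"
  define v where "v = unit_ball_vol (real n)"
  define q where "q = 2 * sqrt t"
  have q: "q > 0" "q\<^sup>2 = 4 * t" using t by (auto simp: q_def power_mult_distrib)
  have "q ^ n = (4 * t) powr (real n / 2)"
  proof -
    have "(4 * t) powr (real n / 2) = (q powr 2) powr (real n / 2)"
      using q by (simp add: powr_numeral)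
    also have "\<dots> = q powr real n" by (simp only: powr_powr) simp
    also have "\<dots> = q ^ n" using q by (simp add: powr_realpow)
    finally show ?thesis by simp
  qed
  then have cq: "c * q ^ n = 1 / pi powr (real n / 2)"
    using t q by (simp add: c_def powr_mult field_simps)
  have G: "Gamma (real n / 2 + 1) = real n / 2 * Gamma (real n / 2)"
    using n Gamma_plus1[of "real n / 2"] by (auto simp: nonpos_Ints_def)
  have Gp: "Gamma (real n / 2) > 0" using n by simp
  \<comment> \<open>Kernel constant times area of the unit sphere times the scaling factor: all
    powers of \<open>pi\<close> and \<open>t\<close> cancel.\<close>
  have K: "c * v * real n * q ^ n = 2 / Gamma (real n / 2)"
  proof -
    have "c * v * real n * q ^ n = (c * q ^ n) * v * real n" by simp
    also have "\<dots> = 2 / Gamma (real n / 2)"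
      unfolding cq v_def unit_ball_vol_def G using n Gp by (simp add: field_simps)
    finally show ?thesis .
  qed
  have "heat_convolution (\<lambda>x :: real ^ 'n. f (norm x)) 0 t =
      c * (LINT y|lborel. (\<lambda>x. exp (- x\<^sup>2 / (4 * t)) * f x) (norm (y :: real ^ 'n)))"
    by (simp add: heat_convolution_def c_def n_def)
  also have "\<dots> = c * (LINT x|lborel. indicator {0..} x * (v * (real n * x ^ (n - 1))) * (exp (- x\<^sup>2 / (4 * t)) * f x))"
    by (subst integral_lborel_radial) (simp_all only: n v_def, measurable)
  also have "\<dots> = c * (\<bar>q\<bar> *\<^sub>R (LINT x|lborel. indicator {0..} (0 + q * x) * (v * (real n * (0 + q * x) ^ (n - 1))) * (exp (- (0 + q * x)\<^sup>2 / (4 * t)) * f (0 + q * x))))"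
    using q by (subst lborel_integral_real_affine[where c = q and t = 0]) simp_all
  also have "\<dots> = (LINT x|lborel. c * (q * (indicator {0..} (0 + q * x) * (v * (real n * (0 + q * x) ^ (n - 1))) * (exp (- (0 + q * x)\<^sup>2 / (4 * t)) * f (0 + q * x)))))"
    using q by simp
  also have "\<dots> = (LINT x|lborel. radial_gauss_density n x * f (q * x))"
  proof (rule Bochner_Integration.integral_cong[OF refl])
    fix x :: real
    have "(q * x)\<^sup>2 / (4 * t) = x\<^sup>2" using q t by (simp add: power_mult_distrib)
    moreover have "indicator {0..} (q * x) = (indicator {0..} x :: real)"
      using q by (auto simp: zero_le_mult_iff split: split_indicator)
    \<comment> \<open>One factor \<open>q\<close> is the Jacobian, the others come from the radial
      weight of degree \<open>n - 1\<close>.\<close>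
    moreover have "q ^ n = q * q ^ (n - 1)" using n by (metis power_minus_mult mult.commute)
    ultimately show "c * (q * (indicator {0..} (0 + q * x) * (v * (real n * (0 + q * x) ^ (n - 1))) * (exp (- (0 + q * x)\<^sup>2 / (4 * t)) * f (0 + q * x)))) =
      radial_gauss_density n x * f (q * x)"
      unfolding radial_gauss_density_def K[symmetric] by (simp add: power_mult_distrib)
  qed
  finally show ?thesis by (simp add: n_def q_def)
qed

subsection \<open>Averages of oscillating functions\<close>

text \<open>A Riemann-Lebesgue statement in which the bounded primitive \<open>F\<close> encodes
  zero mean. Integrating by parts moves the derivative onto the smooth density and gains a factor
  \<open>1 / R\<close>.\<close>

lemma integral_radial_gauss_density_oscillation_tendsto_0:
  fixes F \<psi> :: "real \<Rightarrow> real"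
  assumes n: "n > 0" and F': "\<And>x. (F has_real_derivative \<psi> x) (at x)"
    and \<psi>: "continuous_on UNIV \<psi>" and b\<psi>: "\<And>x. \<bar>\<psi> x\<bar> \<le> C" and bF: "\<And>x. \<bar>F x\<bar> \<le> B"
  shows "((\<lambda>R. LINT x|lborel. radial_gauss_density n x * \<psi> (R * x)) \<longlongrightarrow> 0) at_top"
proof -
  define K where "K = 2 / Gamma (real n / 2)"
  define h where "h = (\<lambda>x. K * (exp (- x\<^sup>2) * x ^ (n - 1)))"
  \<comment> \<open>For \<open>n = 1\<close> the exponent \<open>n - 2\<close> truncates to 0, but
    the coefficient \<open>real (n - 1)\<close> vanishes, so this is still the derivative of
    \<open>h\<close>.\<close>
  define h' where "h' = (\<lambda>x. K * ((real (n - 1) * (exp (- x\<^sup>2) * x ^ (n - 2))) - 2 * (exp (- x\<^sup>2) * x ^ (n - 1 + 1))))"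
  have h: "(h has_real_derivative h' x) (at x)" for x
  proof -
    have "((\<lambda>x. exp (- x\<^sup>2)) has_real_derivative exp (- x\<^sup>2) * (- (2 * x))) (at x)"
      by (auto intro!: derivative_eq_intros)
    from DERIV_cmult[OF DERIV_mult[OF this DERIV_pow[of "n - 1" x]], of K]
    show ?thesis unfolding h_def
      by (rule DERIV_cong) (simp add: h'_def algebra_simps numeral_2_eq_2 del: Suc_1)
  qed
  have \<psi>m [measurable]: "\<psi> \<in> borel_measurable borel"
    using \<psi> by (rule borel_measurable_continuous_onI)
  have Fc: "continuous_on UNIV F"
    by (rule DERIV_continuous_on) (rule has_field_derivative_at_within[OF F'])
  have Fm [measurable]: "F \<in> borel_measurable borel"
    using Fc by (rule borel_measurable_continuous_onI)
  have M: "integrable lborel (\<lambda>x::real. indicator {0..} x *\<^sub>R (exp (-x\<^sup>2)*x^k))" for k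
  proof (cases "even k")
    case True
    then show ?thesis using gaussian_moment_even_pos by (auto elim!: evenE simp: has_bochner_integral_iff)
  next
    case False
    then show ?thesis using gaussian_moment_odd_pos by (auto elim!: oddE simp: has_bochner_integral_iff)
  qed
  have ih': "integrable lborel (\<lambda>x. indicator {0..} x * h' x)"
  proof -
    have "(\<lambda>x. indicator {0..} x * h' x) = (\<lambda>x. K * (real (n - 1) * (indicator {0..} x *\<^sub>R (exp (- x\<^sup>2) * x ^ (n - 2))) - 2 * (indicator {0..} x *\<^sub>R (exp (- x\<^sup>2) * x ^ (n - 1 + 1)))))"
      by (auto simp: h'_def fun_eq_iff algebra_simps split: split_indicator)
    then show ?thesis
      by (simp only:) (intro integrable_mult_right Bochner_Integration.integrable_diff M)
  qed
  have hm [measurable]: "h \<in> borel_measurable borel" "h' \<in> borel_measurable borel"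
    unfolding h_def h'_def by measurable
  have B0: "B \<ge> 0" using bF[of 0] by linarith
  have w: "radial_gauss_density n x = indicator {0..} x * h x" for x
    by (simp add: radial_gauss_density_def h_def K_def)
  define D where "D = (LINT x|lborel. \<bar>indicator {0..} x * h' x\<bar>)"
  have ih'F: "integrable lborel (\<lambda>x. indicator {0..} x * h' x * F (R * x))" for R
  proof (rule Bochner_Integration.integrable_bound)
    show "integrable lborel (\<lambda>x. indicator {0..} x * h' x * B)"
      using ih' by simp
    show "AE x in lborel. norm (indicator {0..} x * h' x * F (R * x)) \<le> norm (indicator {0..} x * h' x * B)"
      using bF B0 by (auto simp: abs_mult intro!: mult_left_mono)
  qed measurable
  have hlim: "(h \<longlongrightarrow> 0) at_top"
    unfolding h_def by real_asymp
  \<comment> \<open>The first summand bounds the boundary term at 0, the second the integral of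
    \<open>h'\<close> against \<open>F\<close>.\<close>
  have bound: "\<bar>LINT x|lborel. radial_gauss_density n x * \<psi> (R * x)\<bar> \<le> (B * \<bar>h 0\<bar> + B * D) / R" if R: "R > 0" for R
  proof -
    \<comment> \<open>integration by parts: \<open>G' = h' F(R x) + R h \<psi>(R x)\<close>\<close>
    define G where "G = (\<lambda>x. h x * F (R * x))"
    define g where "g = (\<lambda>x. h' x * F (R * x) + R * (h x * \<psi> (R * x)))"
    have i1: "integrable lborel (\<lambda>x. radial_gauss_density n x * \<psi> (R * x))"
      by (rule integrable_radial_gauss_density_mult[OF n _ b\<psi>]) measurable
    have gG: "(G has_real_derivative g x) (at x)" for x
      unfolding G_def g_def
      by (rule derivative_eq_intros h F'[THEN DERIV_chain2] | simp)+
    have ge: "(\<lambda>x. indicator {0..} x * g x) = (\<lambda>x. indicator {0..} x * h' x * F (R * x) + R * (radial_gauss_density n x * \<psi> (R * x)))"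
      by (auto simp: g_def w fun_eq_iff split: split_indicator)
    have ig: "integrable lborel (\<lambda>x. indicator {0..} x * g x)"
      unfolding ge by (intro Bochner_Integration.integrable_add ih'F integrable_mult_right i1)
    have h'c: "continuous_on UNIV h'" unfolding h'_def by (intro continuous_intros)
    have hc: "continuous_on UNIV h" unfolding h_def by (intro continuous_intros)
    have gc: "continuous_on UNIV g"
      unfolding g_def
      by (intro continuous_intros h'c hc continuous_on_compose2[OF Fc] continuous_on_compose2[OF \<psi>]) auto
    have Glim: "(G \<longlongrightarrow> 0) at_top"
    proof (rule tendsto_0_le[OF hlim, of _ B])
      show "eventually (\<lambda>x. norm (G x) \<le> norm (h x) * B) at_top"
        using bF by (intro always_eventually allI) (simp add: G_def abs_mult mult_left_mono)
    qed
    \<comment> \<open>The fundamental theorem on \<open>{0..b}\<close> as \<open>b\<close> grows;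
      \<open>G\<close> vanishes at infinity since \<open>h\<close> decays and \<open>F\<close> is
      bounded.\<close>
    have "(LINT x|lborel. indicator {0..} x * g x) = 0 - G 0"
    proof -
      have 1: "((\<lambda>b. LINT x|lborel. indicator {..b} x *\<^sub>R (indicator {0..} x * g x)) \<longlongrightarrow> (LINT x|lborel. indicator {0..} x * g x)) at_top"
        by (rule tendsto_integral_at_top[OF _ ig]) simp
      have "eventually (\<lambda>b. (LINT x|lborel. indicator {..b} x *\<^sub>R (indicator {0..} x * g x)) = G b - G 0) at_top"
        using eventually_ge_at_top[of 0]
      proof eventually_elim
        case (elim b)
        have "(LINT x|lborel. indicator {..b} x *\<^sub>R (indicator {0..} x * g x)) = (LINT x|lborel. indicator {0..b} x *\<^sub>R g x)"
          by (intro Bochner_Integration.integral_cong) (auto split: split_indicator)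
        also have "\<dots> = G b - G 0"
          using elim gG gc
          by (intro integral_FTC_atLeastAtMost)
             (auto simp: has_real_derivative_iff_has_vector_derivative[symmetric]
                intro: has_field_derivative_at_within continuous_on_subset)
        finally show ?case .
      qed
      from tendsto_cong[THEN iffD1, OF this 1]
      have "((\<lambda>b. G b - G 0) \<longlongrightarrow> (LINT x|lborel. indicator {0..} x * g x)) at_top" .
      moreover have "((\<lambda>b. G b - G 0) \<longlongrightarrow> 0 - G 0) at_top" by (intro tendsto_intros Glim)
      ultimately show ?thesis by (rule tendsto_unique[rotated]) simp
    qed
    moreover have "(LINT x|lborel. indicator {0..} x * g x) = (LINT x|lborel. indicator {0..} x * h' x * F (R * x)) + R * (LINT x|lborel. radial_gauss_density n x * \<psi> (R * x))"
      unfolding ge using ih'F i1 by (subst Bochner_Integration.integral_add) auto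
    ultimately have eq: "R * (LINT x|lborel. radial_gauss_density n x * \<psi> (R * x)) = - G 0 - (LINT x|lborel. indicator {0..} x * h' x * F (R * x))"
      by simp
    have "\<bar>LINT x|lborel. indicator {0..} x * h' x * F (R * x)\<bar> \<le> (LINT x|lborel. \<bar>indicator {0..} x * h' x * F (R * x)\<bar>)"
      by (rule integral_abs_bound)
    also have "\<dots> \<le> (LINT x|lborel. B * \<bar>indicator {0..} x * h' x\<bar>)"
    proof (rule integral_mono)
      show "integrable lborel (\<lambda>x. \<bar>indicator {0..} x * h' x * F (R * x)\<bar>)" using ih'F by (rule integrable_abs)
      show "integrable lborel (\<lambda>x. B * \<bar>indicator {0..} x * h' x\<bar>)" using ih' by (intro integrable_mult_right integrable_abs)
      show "\<bar>indicator {0..} x * h' x * F (R * x)\<bar> \<le> B * \<bar>indicator {0..} x * h' x\<bar>" for x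
        using mult_right_mono[OF bF[of "R * x"], of "\<bar>indicator {0..} x * h' x\<bar>"]
        by (simp add: abs_mult mult_ac)
    qed
    also have "\<dots> = B * D" by (simp add: D_def)
    finally have "\<bar>LINT x|lborel. indicator {0..} x * h' x * F (R * x)\<bar> \<le> B * D" .
    moreover have "\<bar>G 0\<bar> \<le> B * \<bar>h 0\<bar>"
      using mult_right_mono[OF bF[of 0], of "\<bar>h 0\<bar>"] by (simp add: G_def abs_mult mult_ac)
    ultimately have "\<bar>R * (LINT x|lborel. radial_gauss_density n x * \<psi> (R * x))\<bar> \<le> B * \<bar>h 0\<bar> + B * D"
      unfolding eq by linarith
    then show ?thesis using R by (simp add: abs_mult field_simps)
  qed
  show ?thesis
  proof (rule Lim_null_comparison)
    show "eventually (\<lambda>R. norm (LINT x|lborel. radial_gauss_density n x * \<psi> (R * x)) \<le> (B * \<bar>h 0\<bar> + B * D) / R) at_top"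
      using eventually_gt_at_top[of 0] by eventually_elim (use bound in simp)
    show "((\<lambda>R. (B * \<bar>h 0\<bar> + B * D) / R) \<longlongrightarrow> 0) at_top" by real_asymp
  qed
qed

lemma abs_sin_diff_le: "\<bar>sin x - sin y\<bar> \<le> \<bar>x - y :: real\<bar>"
proof -
  have "norm (sin x - sin y) \<le> 1 * norm (x - y)"
    by (rule field_differentiable_bound[where S = UNIV and f' = cos])
       (auto intro: DERIV_sin)
  then show ?thesis by simp
qed

text \<open>For fixed \<open>x > 0\<close>, \<open>ln (R * x + 1)\<close> differs from
  \<open>ln R + ln x\<close> by \<open>o(1)\<close>, and the addition theorem then separates
  \<open>R\<close> from \<open>x\<close>. The two coefficients are the real and imaginary parts of
  the expectation of \<open>exp (i m ln |Z|)\<close>. Twice the density dominates.\<close>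

lemma integral_radial_gauss_density_sin_ln:
  assumes n: "n > 0"
  shows "((\<lambda>R. (LINT x|lborel. radial_gauss_density n x * sin (m * ln (R * x + 1))) -
    ((LINT x|lborel. radial_gauss_density n x * cos (m * ln x)) * sin (m * ln R) +
     (LINT x|lborel. radial_gauss_density n x * sin (m * ln x)) * cos (m * ln R))) \<longlongrightarrow> 0) at_top"
proof -
  let ?w = "radial_gauss_density n"
  let ?d = "\<lambda>R x. ?w x * (sin (m * ln (R * x + 1)) - sin (m * ln R + m * ln x))"
  have "((\<lambda>R. LINT x|lborel. ?d R x) \<longlongrightarrow> (LINT x|(lborel :: real measure). 0)) at_top"
  proof (rule integral_dominated_convergence_at_top[where w = "\<lambda>x. ?w x * 2"])
    show "integrable lborel (\<lambda>x. ?w x * 2)" using integrable_radial_gauss_density[OF n] by simp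
    have "\<bar>sin a - sin b\<bar> \<le> 2" for a b :: real
      using abs_sin_le_one[of a] abs_sin_le_one[of b] by linarith
    then show "\<forall>\<^sub>F R in at_top. AE x in lborel. norm (?d R x) \<le> ?w x * 2"
      using radial_gauss_density_nonneg[OF n]
      by (intro always_eventually allI AE_I2) (simp add: abs_mult mult_left_mono)
    \<comment> \<open>The splitting of the logarithm fails at the null set \<open>x = 0\<close>; for
      \<open>x < 0\<close> the density is zero.\<close>
    have "((\<lambda>R. ?d R x) \<longlongrightarrow> 0) at_top" if "x \<noteq> 0" for x
    proof (cases "x < 0")
      case False
      then have x: "x > 0" using that by simp
      have "((\<lambda>R. m * ln (R * x + 1) - (m * ln R + m * ln x)) \<longlongrightarrow> 0) at_top"
        using x by real_asymp
      then have "((\<lambda>R. \<bar>m * ln (R * x + 1) - (m * ln R + m * ln x)\<bar>) \<longlongrightarrow> 0) at_top"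
        by (rule tendsto_rabs_zero)
      then have "((\<lambda>R. sin (m * ln (R * x + 1)) - sin (m * ln R + m * ln x)) \<longlongrightarrow> 0) at_top"
        by (rule Lim_null_comparison[rotated]) (intro always_eventually allI, simp add: abs_sin_diff_le)
      then show ?thesis by (rule tendsto_mult_right_zero)
    qed (simp add: radial_gauss_density_def)
    then show "AE x in lborel. ((\<lambda>R. ?d R x) \<longlongrightarrow> 0) at_top"
      using AE_lborel_singleton[of 0] by (auto elim: eventually_mono)
  qed measurable
  then have *: "((\<lambda>R. LINT x|lborel. ?d R x) \<longlongrightarrow> 0) at_top" by simp
  have i: "integrable lborel (\<lambda>x. ?w x * sin (m * ln (R * x + 1)))"
    "integrable lborel (\<lambda>x. ?w x * cos (m * ln x))" "integrable lborel (\<lambda>x. ?w x * sin (m * ln x))" for R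
    by (rule integrable_radial_gauss_density_mult[OF n, where B = 1]; (measurable; fail | simp))+
  have "(LINT x|lborel. ?d R x) = (LINT x|lborel. ?w x * sin (m * ln (R * x + 1))) -
    ((LINT x|lborel. ?w x * cos (m * ln x)) * sin (m * ln R) +
     (LINT x|lborel. ?w x * sin (m * ln x)) * cos (m * ln R))" for R
  proof -
    have "?d R x = ?w x * sin (m * ln (R * x + 1)) - (?w x * cos (m * ln x) * sin (m * ln R) + ?w x * sin (m * ln x) * cos (m * ln R))" for x
      by (simp add: sin_add algebra_simps)
    then show ?thesis
      using i by (simp add: Bochner_Integration.integral_diff Bochner_Integration.integral_add)
  qed
  with * show ?thesis by simp
qed

text \<open>Provides small frequencies at which averaging hardly damps the logarithmic oscillation.
  The cosine part suffices, being a lower bound for the full amplitude.\<close>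

lemma integral_radial_gauss_density_cos_ln_tendsto_1:
  assumes n: "n > 0"
  shows "(\<lambda>k. LINT x|lborel. radial_gauss_density n x * cos (1 / real (Suc k) * ln x)) \<longlonglongrightarrow> 1"
proof -
  have "(\<lambda>k. LINT x|lborel. radial_gauss_density n x * cos (1 / real (Suc k) * ln x)) \<longlonglongrightarrow> (LINT x|lborel. radial_gauss_density n x)"
  proof (rule integral_dominated_convergence[where w = "radial_gauss_density n"])
    show "AE x in lborel. (\<lambda>k. radial_gauss_density n x * cos (1 / real (Suc k) * ln x)) \<longlonglongrightarrow> radial_gauss_density n x"
    proof (rule AE_I2)
      fix x
      have "(\<lambda>k. radial_gauss_density n x * cos (1 / real (Suc k) * ln x)) \<longlonglongrightarrow> radial_gauss_density n x * cos (0 * ln x)"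
        by (intro tendsto_intros LIMSEQ_Suc[OF lim_1_over_n])
      then show "(\<lambda>k. radial_gauss_density n x * cos (1 / real (Suc k) * ln x)) \<longlonglongrightarrow> radial_gauss_density n x"
        by simp
    qed
    show "AE x in lborel. norm (radial_gauss_density n x * cos (1 / real (Suc k) * ln x)) \<le> radial_gauss_density n x" for k
      using mult_left_mono[OF abs_cos_le_one radial_gauss_density_nonneg[OF n]] radial_gauss_density_nonneg[OF n]
      by (intro AE_I2) (simp add: abs_mult)
  qed (auto intro: integrable_radial_gauss_density[OF n])
  then show ?thesis by (simp add: integral_radial_gauss_density[OF n])
qed

subsection \<open>Periodic functions of zero mean\<close>

text \<open>Since \<open>F\<close> is periodic, \<open>c\<close> must be the mean of the even cosine
  power. The recursion is that of Wallis, and the invariant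
  \<open>c\<^sup>2 * (2 * N + 1) \<le> 1\<close> forces \<open>c\<close> to 0 as \<open>N\<close>
  grows, with no closed form.\<close>

lemma cos_power_primitive:
  "\<exists>(c::real) F. 0 \<le> c \<and> c\<^sup>2 * (2 * real N + 1) \<le> 1 \<and>
    (\<forall>x. (F has_real_derivative cos x ^ (2 * N) - c) (at x)) \<and> (\<forall>x. F (x + 2 * pi) = F x) \<and> (\<exists>B. \<forall>x. \<bar>F x\<bar> \<le> B)"
proof (induction N)
  case 0
  show ?case by (rule exI[of _ 1], rule exI[of _ "\<lambda>_. 0"]) auto
next
  case (Suc N)
  then obtain c F B where c: "0 \<le> c" "c\<^sup>2 * (2 * real N + 1) \<le> 1"
    and F: "\<And>x. (F has_real_derivative cos x ^ (2 * N) - c) (at x)" "\<And>x. F (x + 2 * pi) = F x" "\<And>x. \<bar>F x\<bar> \<le> B"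
    by blast
  define q :: real where "q = (2 * real N + 1) / (2 * real N + 2)"
  \<comment> \<open>The reduction formula for the integral of \<open>cos x ^ (2 * N + 2)\<close>; it
    multiplies the mean by \<open>q\<close>.\<close>
  define G where "G = (\<lambda>x. cos x ^ (2 * N + 1) * sin x / (2 * real N + 2) + q * F x)"
  have q: "0 \<le> q" "q \<le> 1" by (auto simp: q_def)
  show ?case
  proof (intro exI conjI allI)
    show "0 \<le> q * c" using q c by simp
    have "(2 * real N + 1) * (2 * real N + 3) \<le> (2 * real N + 2)\<^sup>2"
      by (simp add: power2_eq_square algebra_simps)
    then have "(q * c)\<^sup>2 * (2 * real (Suc N) + 1) \<le> c\<^sup>2 * (2 * real N + 1)"
    proof -
      have "(q * c)\<^sup>2 * (2 * real (Suc N) + 1) = c\<^sup>2 * (2 * real N + 1) * ((2 * real N + 1) * (2 * real N + 3) / (2 * real N + 2)\<^sup>2)"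
        by (simp add: q_def power2_eq_square algebra_simps)
      also have "\<dots> \<le> c\<^sup>2 * (2 * real N + 1) * 1"
        using \<open>_ \<le> (2 * real N + 2)\<^sup>2\<close> by (intro mult_left_mono) (auto simp: divide_le_eq_1)
      finally show ?thesis by simp
    qed
    with c show "(q * c)\<^sup>2 * (2 * real (Suc N) + 1) \<le> 1" by linarith
    show "(G has_real_derivative cos x ^ (2 * Suc N) - q * c) (at x)" for x
    proof -
      have "(G has_real_derivative ((2 * real N + 1) * cos x ^ (2 * N) * (- sin x) * sin x + cos x ^ (2 * N + 1) * cos x) / (2 * real N + 2) + q * (cos x ^ (2 * N) - c)) (at x)"
        unfolding G_def
        by (rule derivative_eq_intros F refl | simp)+
      moreover have "((2 * real N + 1) * cos x ^ (2 * N) * (- sin x) * sin x + cos x ^ (2 * N + 1) * cos x) / (2 * real N + 2) + q * (cos x ^ (2 * N) - c) = cos x ^ (2 * Suc N) - q * c"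
      proof -
        have s: "sin x * sin x = 1 - cos x * cos x" using sin_cos_squared_add[of x] by (simp add: power2_eq_square)
        have "(2 * real N + 1) * cos x ^ (2 * N) * (- sin x) * sin x + cos x ^ (2 * N + 1) * cos x = - ((2 * real N + 1) * cos x ^ (2 * N) * (sin x * sin x)) + cos x ^ (2 * N) * (cos x * cos x)"
          by (simp add: mult_ac)
        also have "\<dots> = (2 * real N + 2) * (cos x ^ (2 * N) * (cos x * cos x)) - (2 * real N + 1) * cos x ^ (2 * N)"
          unfolding s by (simp add: algebra_simps)
        finally have "((2 * real N + 1) * cos x ^ (2 * N) * (- sin x) * sin x + cos x ^ (2 * N + 1) * cos x) / (2 * real N + 2) = cos x ^ (2 * N) * (cos x * cos x) - q * cos x ^ (2 * N)"
          by (simp add: q_def diff_divide_distrib)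
        then show ?thesis by (simp add: algebra_simps)
      qed
      ultimately show ?thesis by simp
    qed
    show "G (x + 2 * pi) = G x" for x by (simp add: G_def F)
    show "\<bar>G x\<bar> \<le> 1 + B" for x
    proof -
      have "\<bar>cos x ^ (2 * N + 1)\<bar> \<le> 1" unfolding power_abs by (rule power_le_one) auto
      then have "\<bar>cos x ^ (2 * N + 1) * sin x\<bar> \<le> 1 * 1"
        unfolding abs_mult by (intro mult_mono) auto
      then have "\<bar>cos x ^ (2 * N + 1) * sin x / (2 * real N + 2)\<bar> \<le> 1" by simp
      moreover have "\<bar>q * F x\<bar> \<le> 1 * B" unfolding abs_mult using q F(3)[of x] by (intro mult_mono) auto
      ultimately show ?thesis unfolding G_def by linarith
    qed
  qed
qed

text \<open>
  Both \<open>cos\<^bsup>2N\<^esup>\<close> and \<open>1 - sin\<^bsup>2N\<^esup>\<close> have range \<open>[0, 1]\<close>, attained at the same points \<open>0\<close> and \<open>\<pi>/2\<close>, but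
  their means tend to \<open>0\<close> and \<open>1\<close>. So a convex combination has any given mean in \<open>(0, 1)\<close>.
\<close>

lemma periodic_zero_mean_with_range:
  fixes a b :: real
  assumes a: "a > 0" and b: "b > 0"
  obtains F \<psi> B p q where "continuous_on UNIV \<psi>" "\<And>x. (F has_real_derivative \<psi> x) (at x)"
    "\<And>x. \<psi> (x + 2 * pi) = \<psi> x" "\<And>x. F (x + 2 * pi) = F x" "\<And>x. \<bar>F x\<bar> \<le> B"
    "\<And>x. \<psi> x \<le> a" "\<And>x. - b \<le> \<psi> x" "\<psi> p = a" "\<psi> q = - b"
proof -
  \<comment> \<open>The mean that \<open>g\<close>, with range in \<open>[0, 1]\<close>, must have
    for \<open>(a + b) * g - b\<close> to have mean zero.\<close>
  define \<theta> where "\<theta> = b / (a + b)"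
  have \<theta>: "0 < \<theta>" "\<theta> < 1" using a b by (auto simp: \<theta>_def)
  define e where "e = min \<theta> (1 - \<theta>)"
  have e: "0 < e" "e \<le> 1 / 2" using \<theta> by (auto simp: e_def min_def)
  \<comment> \<open>Large enough that the invariant on \<open>c\<close> gives \<open>c < e\<close>,
    which places \<open>\<theta>\<close> strictly between the means \<open>c\<close> and
    \<open>1 - c\<close>.\<close>
  obtain N where N: "real N > 1 / e\<^sup>2" using reals_Archimedean2 by blast
  have N0: "N > 0" using N e by (cases N) auto
  obtain c F B where c: "0 \<le> c" "c\<^sup>2 * (2 * real N + 1) \<le> 1"
    and F: "\<And>x. (F has_real_derivative cos x ^ (2 * N) - c) (at x)" "\<And>x. F (x + 2 * pi) = F x" "\<And>x. \<bar>F x\<bar> \<le> B"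
    using cos_power_primitive[of N] by blast
  have "c < e"
  proof (rule ccontr)
    assume "\<not> c < e"
    then have "e\<^sup>2 \<le> c\<^sup>2" using e by (intro power_mono) auto
    then have "e\<^sup>2 * (2 * real N + 1) \<le> 1" using c by (meson mult_right_mono order_trans of_nat_0_le_iff add_nonneg_nonneg zero_le_one mult_nonneg_nonneg zero_le_numeral)
    moreover have "e\<^sup>2 * real N > 1" using N e by (simp add: field_simps)
    moreover have "e\<^sup>2 * (2 * real N + 1) = 2 * (e\<^sup>2 * real N) + e\<^sup>2" by (simp add: algebra_simps)
    ultimately show False using zero_le_power2[of e] by linarith
  qed
  \<comment> \<open>The solution of \<open>l * c + (1 - l) * (1 - c) = \<theta>\<close>.\<close>
  define l where "l = (1 - c - \<theta>) / (1 - 2 * c)"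
  have c2: "1 - 2 * c > 0" using \<open>c < e\<close> e by linarith
  have "c < \<theta>" "c < 1 - \<theta>" using \<open>c < e\<close> by (auto simp: e_def)
  then have l: "0 \<le> l" "l \<le> 1" using c2 by (auto simp: l_def)
  have "l * (1 - 2 * c) = 1 - c - \<theta>" using c2 by (simp add: l_def)
  then have mean: "l * c + (1 - l) * (1 - c) = \<theta>" by (simp add: algebra_simps)
  define g where "g = (\<lambda>x::real. l * cos x ^ (2 * N) + (1 - l) * (1 - sin x ^ (2 * N)))"
  define \<psi> where "\<psi> = (\<lambda>x. (a + b) * g x - b)"
  \<comment> \<open>Shifting by \<open>pi / 2\<close> turns the primitive for the cosine power into
    one for the sine power.\<close>
  define P where "P = (\<lambda>x. (a + b) * (l * F x - (1 - l) * F (x - pi / 2)))"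
  have "\<psi> x = (a + b) * (l * (cos x ^ (2 * N) - c) - (1 - l) * (sin x ^ (2 * N) - c))" for x
  proof -
    have "(a + b) * \<theta> = b" using a b by (simp add: \<theta>_def)
    then have "\<psi> x = (a + b) * (g x - (l * c + (1 - l) * (1 - c)))"
      unfolding mean by (simp add: \<psi>_def right_diff_distrib)
    then show ?thesis by (simp add: g_def algebra_simps)
  qed
  note \<psi>_eq = this
  show thesis
  proof (rule that[of \<psi> P "(a + b) * (B + B)" 0 "pi / 2"])
    show "continuous_on UNIV \<psi>" unfolding \<psi>_def g_def by (intro continuous_intros)
    show "(P has_real_derivative \<psi> x) (at x)" for x
    proof -
      have "((\<lambda>x. F (x - pi / 2)) has_real_derivative (cos (x - pi / 2) ^ (2 * N) - c) * 1) (at x)"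
        by (rule DERIV_chain2[OF F(1)]) (auto intro!: derivative_eq_intros)
      then have "((\<lambda>x. F (x - pi / 2)) has_real_derivative (sin x ^ (2 * N) - c)) (at x)"
        by (simp add: cos_diff)
      with F(1)[of x] show ?thesis unfolding P_def \<psi>_eq
        by (auto intro!: derivative_eq_intros)
    qed
    show "\<psi> (x + 2 * pi) = \<psi> x" for x by (simp add: \<psi>_def g_def)
    show "P (x + 2 * pi) = P x" for x using F(2)[of x] F(2)[of "x - pi / 2"] by (simp add: P_def algebra_simps)
    show "\<bar>P x\<bar> \<le> (a + b) * (B + B)" for x
    proof -
      have "\<bar>l * F x\<bar> \<le> 1 * B" "\<bar>(1 - l) * F (x - pi / 2)\<bar> \<le> 1 * B"
        using l mult_mono[OF l(2) F(3)[of x]] mult_mono[of "1 - l" 1, OF _ F(3)[of "x - pi / 2"]]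
        by (simp_all add: abs_mult)
      then have "\<bar>l * F x - (1 - l) * F (x - pi / 2)\<bar> \<le> B + B" by linarith
      then show ?thesis unfolding P_def abs_mult using a b by simp
    qed
    have cs: "0 \<le> cos x ^ (2 * N)" "cos x ^ (2 * N) \<le> 1" "0 \<le> sin x ^ (2 * N)" "sin x ^ (2 * N) \<le> 1" for x :: real
      by (simp_all add: power_mult power_le_one abs_square_le_1)
    have g: "0 \<le> g x" "g x \<le> 1" for x
    proof -
      show "0 \<le> g x" unfolding g_def using l cs by (intro add_nonneg_nonneg mult_nonneg_nonneg) auto
      have "g x \<le> l * 1 + (1 - l) * 1" unfolding g_def using l cs by (intro add_mono mult_left_mono) auto
      then show "g x \<le> 1" by simp
    qed
    show "\<psi> x \<le> a" for x
      using mult_left_mono[OF g(2)[of x] less_imp_le[OF add_pos_pos[OF a b]]] unfolding \<psi>_def by simp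
    show "- b \<le> \<psi> x" for x
      using mult_nonneg_nonneg[OF less_imp_le[OF add_pos_pos[OF a b]] g(1)[of x]] unfolding \<psi>_def by simp
    show "\<psi> 0 = a" "\<psi> (pi / 2) = - b" using N0 by (simp_all add: \<psi>_def g_def power_0_left)
  qed
qed

subsection \<open>Limits superior and inferior\<close>

lemma Limsup_at_top_eqI:
  fixes f :: "real \<Rightarrow> real"
  assumes le: "\<And>e. e > 0 \<Longrightarrow> eventually (\<lambda>x. f x < L + e) at_top"
    and X: "filterlim X at_top sequentially" "(\<lambda>j. f (X j)) \<longlonglongrightarrow> L"
  shows "Limsup at_top (\<lambda>x. ereal (f x)) = ereal L"
proof (rule antisym)
  show "Limsup at_top (\<lambda>x. ereal (f x)) \<le> ereal L"
    unfolding Limsup_le_iff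
  proof safe
    fix y assume y: "ereal L < y"
    then obtain z where z: "ereal L < ereal z" "ereal z < y" using ereal_dense2 by blast
    then have "eventually (\<lambda>x. f x < L + (z - L)) at_top" by (intro le) auto
    then show "eventually (\<lambda>x. ereal (f x) < y) at_top"
      by eventually_elim (use z in \<open>auto intro: less_trans[of _ "ereal z"]\<close>)
  qed
  show "ereal L \<le> Limsup at_top (\<lambda>x. ereal (f x))"
  proof (rule ccontr)
    assume "\<not> ?thesis"
    then obtain z where z: "Limsup at_top (\<lambda>x. ereal (f x)) < ereal z" "ereal z < ereal L"
      using ereal_dense2 not_le by metis
    from Limsup_lessD[OF z(1)] X(1) have "eventually (\<lambda>j. ereal (f (X j)) < ereal z) sequentially"
      by (rule eventually_compose_filterlim)
    then have "eventually (\<lambda>j. f (X j) \<le> z) sequentially" by eventually_elim simp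
    then have "L \<le> z" using tendsto_upperbound[OF X(2)] by simp
    then show False using z by simp
  qed
qed

lemma Liminf_at_top_eqI:
  fixes f :: "real \<Rightarrow> real"
  assumes le: "\<And>e. e > 0 \<Longrightarrow> eventually (\<lambda>x. f x > L - e) at_top"
    and X: "filterlim X at_top sequentially" "(\<lambda>j. f (X j)) \<longlonglongrightarrow> L"
  shows "Liminf at_top (\<lambda>x. ereal (f x)) = ereal L"
proof -
  have "Limsup at_top (\<lambda>x. ereal (- f x)) = ereal (- L)"
  proof (rule Limsup_at_top_eqI[OF _ X(1)])
    show "eventually (\<lambda>x. - f x < - L + e) at_top" if "e > 0" for e
      using le[OF that] by eventually_elim simp
  qed (intro tendsto_intros X)
  then have "- Liminf at_top (\<lambda>x. ereal (f x)) = - ereal L"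
    by (subst ereal_Limsup_uminus[symmetric]) simp
  then show ?thesis by (metis ereal_uminus_eq_iff)
qed

text \<open>Solve \<open>m * ln x + \<delta> = \<theta> + 2 * pi * j\<close> for \<open>x\<close>:
  the solutions form a geometric sequence.\<close>

lemma ln_phase_sequence:
  fixes m \<delta> \<theta> :: real
  assumes m: "m > 0"
  obtains X where "filterlim X at_top sequentially" "\<And>j. X j > 0" "\<And>j. sin (m * ln (X j) + \<delta>) = sin \<theta>"
proof
  let ?X = "\<lambda>j. exp ((\<theta> - \<delta> + 2 * pi * real j) / m)"
  show "filterlim ?X at_top sequentially" using m by real_asymp
  show "?X j > 0" for j by simp
  show "sin (m * ln (?X j) + \<delta>) = sin \<theta>" for j
  proof -
    have "m * ln (?X j) + \<delta> = \<theta> + of_int (int j) * (2 * pi)" using m by simp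
    then show ?thesis using sin.plus_of_int[of \<theta> "int j"] by simp
  qed
qed

text \<open>The logarithmic phase is asymptotically constant over one period of
  \<open>\<psi>\<close>, so both phases can be prescribed at once. This makes the extremes of the
  two parts of the datum add up.\<close>

lemma ln_phase_periodic_sequence:
  fixes \<psi> :: "real \<Rightarrow> real"
  assumes m: "m > 0" and per: "\<And>x. \<psi> (x + 2 * pi) = \<psi> x"
  obtains Y where "filterlim Y at_top sequentially"
    "(\<lambda>j. C * sin (m * ln (Y j + 1)) + D + \<psi> (Y j)) \<longlonglongrightarrow> C * sin \<theta> + D + \<psi> p"
proof -
  interpret per: periodic_fun_simple \<psi> "2 * pi" by unfold_locales (rule per)
  obtain X where X: "filterlim X at_top sequentially" "\<And>j. X j > 0" "\<And>j. sin (m * ln (X j) + 0) = sin \<theta>"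
    using ln_phase_sequence[OF m] by blast
  \<comment> \<open>\<open>X\<close> has the right logarithmic phase; rounding it to a point
    congruent to \<open>p\<close> modulo \<open>2 * pi\<close> moves it by a bounded amount, so
    \<open>(Y j + 1) / X j\<close> tends to 1.\<close>
  define Y where "Y = (\<lambda>j. p + of_int \<lfloor>X j / (2 * pi)\<rfloor> * (2 * pi))"
  have b: "X j - 2 * pi \<le> of_int \<lfloor>X j / (2 * pi)\<rfloor> * (2 * pi)" "of_int \<lfloor>X j / (2 * pi)\<rfloor> * (2 * pi) \<le> X j" for j
  proof -
    have "X j / (2 * pi) - 1 \<le> of_int \<lfloor>X j / (2 * pi)\<rfloor>" by linarith
    from mult_right_mono[OF this, of "2 * pi"]
    show "X j - 2 * pi \<le> of_int \<lfloor>X j / (2 * pi)\<rfloor> * (2 * pi)" by (simp add: left_diff_distrib)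
    show "of_int \<lfloor>X j / (2 * pi)\<rfloor> * (2 * pi) \<le> X j"
      using mult_right_mono[OF of_int_floor_le[of "X j / (2 * pi)"], of "2 * pi"] by simp
  qed
  have Y: "filterlim Y at_top sequentially"
  proof (rule filterlim_at_top_mono)
    show "filterlim (\<lambda>j. (p - 2 * pi) + X j) at_top sequentially"
      by (rule filterlim_tendsto_add_at_top[OF tendsto_const X(1)])
    show "\<forall>\<^sub>F j in sequentially. (p - 2 * pi) + X j \<le> Y j"
      using b(1) by (intro always_eventually allI) (simp add: Y_def algebra_simps)
  qed
  have \<psi>Y: "\<psi> (Y j) = \<psi> p" for j unfolding Y_def by (rule per.plus_of_int)
  define K where "K = \<bar>p\<bar> + 1 + 2 * pi"
  have "((\<lambda>j. (Y j + 1 - X j) / X j) \<longlongrightarrow> 0) sequentially"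
  proof (rule Lim_null_comparison)
    have "\<bar>Y j + 1 - X j\<bar> \<le> K" for j using b[of j] unfolding Y_def K_def by linarith
    then show "\<forall>\<^sub>F j in sequentially. norm ((Y j + 1 - X j) / X j) \<le> K / X j"
      using X(2) by (intro always_eventually allI) (simp add: abs_of_pos divide_right_mono less_imp_le)
    show "((\<lambda>j. K / X j) \<longlongrightarrow> 0) sequentially"
      by (rule tendsto_divide_0[OF tendsto_const filterlim_at_top_imp_at_infinity[OF X(1)]])
  qed
  from tendsto_add[OF this tendsto_const[of 1]] have "((\<lambda>j. (Y j + 1 - X j) / X j + 1) \<longlongrightarrow> 1) sequentially"
    by simp
  moreover have "(Y j + 1 - X j) / X j + 1 = (Y j + 1) / X j" for j using X(2)[of j] by (simp add: field_simps)
  ultimately have "((\<lambda>j. (Y j + 1) / X j) \<longlongrightarrow> 1) sequentially" by simp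
  then have "((\<lambda>j. m * ln ((Y j + 1) / X j)) \<longlongrightarrow> m * ln 1) sequentially"
    by (intro tendsto_intros) auto
  then have *: "((\<lambda>j. \<bar>m * ln ((Y j + 1) / X j)\<bar>) \<longlongrightarrow> 0) sequentially"
    by (intro tendsto_rabs_zero) simp
  have "eventually (\<lambda>j. Y j \<ge> 0) sequentially" using Y by (simp add: filterlim_at_top)
  then have "eventually (\<lambda>j. norm (sin (m * ln (Y j + 1)) - sin \<theta>) \<le> \<bar>m * ln ((Y j + 1) / X j)\<bar>) sequentially"
  proof eventually_elim
    case (elim j)
    have "m * ln ((Y j + 1) / X j) = m * ln (Y j + 1) - m * ln (X j)"
      using elim X(2)[of j] by (simp add: ln_div right_diff_distrib)
    then show ?case using abs_sin_diff_le[of "m * ln (Y j + 1)" "m * ln (X j)"] X(3)[of j] by simp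
  qed
  then have "((\<lambda>j. sin (m * ln (Y j + 1)) - sin \<theta>) \<longlongrightarrow> 0) sequentially"
    using * by (rule Lim_null_comparison)
  then have "(\<lambda>j. sin (m * ln (Y j + 1))) \<longlonglongrightarrow> sin \<theta>" by (rule LIM_zero_cancel)
  then have "(\<lambda>j. C * sin (m * ln (Y j + 1)) + D + \<psi> (Y j)) \<longlonglongrightarrow> C * sin \<theta> + D + \<psi> p"
    unfolding \<psi>Y by (intro tendsto_add tendsto_mult_left tendsto_const)
  with Y show thesis by (rule that)
qed

text \<open>The slow phase passes through every value at arbitrarily late times, so both extremes of
  the sine are reached; the bounds on the sine give the other inequalities.\<close>

lemma Limsup_Liminf_log_oscillation:
  fixes u :: "real \<Rightarrow> real"
  assumes m: "m > 0" and d: "d \<ge> 0"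
    and lim: "((\<lambda>t. u t - (c + d * sin (m * ln (2 * sqrt t) + \<delta>))) \<longlongrightarrow> 0) at_top"
  shows "Limsup at_top (\<lambda>t. ereal (u t)) = ereal (c + d)"
    and "Liminf at_top (\<lambda>t. ereal (u t)) = ereal (c - d)"
proof -
  have seq: "\<exists>T. filterlim T at_top sequentially \<and> (\<lambda>j. u (T j)) \<longlonglongrightarrow> c + d * sin \<theta>" for \<theta>
  proof -
    obtain X where X: "filterlim X at_top sequentially" "\<And>j. X j > 0" "\<And>j. sin (m * ln (X j) + \<delta>) = sin \<theta>"
      using ln_phase_sequence[OF m] by blast
    \<comment> \<open>Chosen so that \<open>2 * sqrt t\<close> equals \<open>X j\<close>.\<close>
    let ?T = "\<lambda>j. (X j / 2)\<^sup>2"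
    have T: "filterlim ?T at_top sequentially"
    proof (rule filterlim_compose[OF _ X(1)])
      show "filterlim (\<lambda>x::real. (x / 2)\<^sup>2) at_top at_top" by real_asymp
    qed
    have s: "2 * sqrt (?T j) = X j" for j using X(2)[of j] by (simp add: real_sqrt_abs)
    from filterlim_compose[OF lim T]
    have "(\<lambda>j. u (?T j) - (c + d * sin \<theta>)) \<longlonglongrightarrow> 0" unfolding s X(3) .
    then have "(\<lambda>j. u (?T j)) \<longlonglongrightarrow> c + d * sin \<theta>" by (rule LIM_zero_cancel)
    with T show ?thesis by blast
  qed
  have sd: "d * sin x \<le> d" "- d \<le> d * sin x" for x
    using mult_left_mono[OF sin_le_one d, of x] mult_left_mono[OF sin_ge_minus_one d, of x] by simp_all
  have ev: "eventually (\<lambda>t. \<bar>u t - (c + d * sin (m * ln (2 * sqrt t) + \<delta>))\<bar> < e) at_top" if "e > 0" for e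
    using tendstoD[OF lim that] by (simp add: dist_real_def)
  show "Limsup at_top (\<lambda>t. ereal (u t)) = ereal (c + d)"
  proof -
    obtain T where T: "filterlim T at_top sequentially" "(\<lambda>j. u (T j)) \<longlonglongrightarrow> c + d * sin (pi / 2)" using seq by blast
    show ?thesis
    proof (rule Limsup_at_top_eqI[OF _ T(1)])
      show "eventually (\<lambda>t. u t < c + d + e) at_top" if "e > 0" for e
        using ev[OF that]
      proof eventually_elim
        case (elim t)
        then show ?case using sd(1)[of "m * ln (2 * sqrt t) + \<delta>"] by linarith
      qed
    qed (use T in simp)
  qed
  show "Liminf at_top (\<lambda>t. ereal (u t)) = ereal (c - d)"
  proof -
    obtain T where T: "filterlim T at_top sequentially" "(\<lambda>j. u (T j)) \<longlonglongrightarrow> c + d * sin (- (pi / 2))" using seq by blast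
    show ?thesis
    proof (rule Liminf_at_top_eqI[OF _ T(1)])
      show "eventually (\<lambda>t. c - d - e < u t) at_top" if "e > 0" for e
        using ev[OF that]
      proof eventually_elim
        case (elim t)
        then show ?case using sd(2)[of "m * ln (2 * sqrt t) + \<delta>"] by linarith
      qed
    qed (use T in simp)
  qed
qed

subsection \<open>The prescribed oscillation\<close>

theorem theorem8:
  fixes r \<alpha> \<beta> s :: real
  assumes "r < \<alpha>" and "\<alpha> < \<beta>" and "\<beta> < s"
  shows "\<exists>(\<phi> :: real ^ 'n \<Rightarrow> real) (f :: real \<Rightarrow> real).
    continuous_on UNIV \<phi> \<and> bounded (range \<phi>) \<and> (\<forall>x. \<phi> x = f (norm x)) \<and>
    Liminf at_top (\<lambda>\<tau>. ereal (f \<tau>)) = ereal r \<and>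
    Liminf at_top (\<lambda>t. ereal (heat_convolution \<phi> 0 t)) = ereal \<alpha> \<and>
    Limsup at_top (\<lambda>t. ereal (heat_convolution \<phi> 0 t)) = ereal \<beta> \<and>
    Limsup at_top (\<lambda>\<tau>. ereal (f \<tau>)) = ereal s \<and>
    (\<exists>(m :: real) (C\<^sub>1 :: real) (C\<^sub>2 :: real) (\<psi> :: real \<Rightarrow> real).
      m > 0 \<and> C\<^sub>1 > 0 \<and>
      continuous_on UNIV \<psi> \<and> (\<forall>\<tau>. \<psi> (\<tau> + 2 * pi) = \<psi> \<tau>) \<and> (\<exists>\<tau>. \<psi> \<tau> \<noteq> 0) \<and>
      1 / (2 * pi) * integral {0..2 * pi} \<psi> = 0 \<and>
      (\<forall>\<tau>\<ge>0. f \<tau> = (C\<^sub>1 * sin (m * ln (\<tau> + 1)) + C\<^sub>2) + \<psi> \<tau>))"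
proof -
  let ?w = "radial_gauss_density CARD('n)"
  have n: "CARD('n) > 0" by simp
  \<comment> \<open>\<open>D\<close> and \<open>d\<close> are centre and amplitude of the desired
    oscillation of the solution. An amplitude below \<open>M\<close> for the logarithmic part keeps
    the datum strictly inside \<open>(r, s)\<close> before \<open>\<psi>\<close> is added.\<close>
  define D where "D = (\<alpha> + \<beta>) / 2"
  define d where "d = (\<beta> - \<alpha>) / 2"
  define M where "M = min (s - D) (D - r)"
  have d: "0 < d" "d < M" "M > 0" using assms by (auto simp: d_def M_def D_def field_simps)
  \<comment> \<open>Damping weaker than \<open>d / M\<close> is exactly what makes
    \<open>C = d / \<rho>\<close> smaller than \<open>M\<close>.\<close>
  obtain k where k: "(LINT x|lborel. ?w x * cos (1 / real (Suc k) * ln x)) > d / M"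
    using order_tendstoD(1)[OF integral_radial_gauss_density_cos_ln_tendsto_1[OF n], of "d / M"] d
    by (auto simp: eventually_sequentially)
  define m where "m = 1 / real (Suc k)"
  have m: "m > 0" by (simp add: m_def)
  define A where "A = (LINT x|lborel. ?w x * cos (m * ln x))"
  define B where "B = (LINT x|lborel. ?w x * sin (m * ln x))"
  define \<rho> where "\<rho> = sqrt (A\<^sup>2 + B\<^sup>2)"
  have A: "A > d / M" using k by (simp add: A_def m_def)
  have "A \<le> \<rho>" unfolding \<rho>_def by (rule real_le_rsqrt) simp
  then have \<rho>: "\<rho> > d / M" using A by simp
  moreover have "d / M > 0" using d by simp
  ultimately have \<rho>0: "\<rho> > 0" by linarith
  \<comment> \<open>Polar form of the point \<open>(A, B)\<close>, which merges the sine and cosine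
    terms into one shifted sine of amplitude \<open>\<rho>\<close>.\<close>
  obtain \<delta> where \<delta>: "A = \<rho> * cos \<delta>" "B = \<rho> * sin \<delta>"
  proof -
    have "\<rho>\<^sup>2 = A\<^sup>2 + B\<^sup>2" by (simp add: \<rho>_def)
    moreover have "(A / \<rho>)\<^sup>2 + (B / \<rho>)\<^sup>2 = (A\<^sup>2 + B\<^sup>2) / \<rho>\<^sup>2"
      by (simp add: power_divide add_divide_distrib)
    ultimately have "(A / \<rho>)\<^sup>2 + (B / \<rho>)\<^sup>2 = \<rho>\<^sup>2 / \<rho>\<^sup>2" by (simp only:)
    also have "\<dots> = 1" using \<rho>0 by simp
    finally obtain \<delta> where "0 \<le> \<delta>" "\<delta> < 2 * pi" "A / \<rho> = cos \<delta>" "B / \<rho> = sin \<delta>"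
      by (rule sincos_total_2pi)
    moreover have "\<rho> * (A / \<rho>) = A" "\<rho> * (B / \<rho>) = B" using \<rho>0 by simp_all
    ultimately show thesis by (intro that[of \<delta>]) (simp_all only:)
  qed
  define C where "C = d / \<rho>"
  have C: "C > 0" "C < M" using \<rho> \<rho>0 d by (simp_all add: C_def pos_divide_less_eq mult.commute)
  have C\<rho>: "C * \<rho> = d" using \<rho>0 by (simp add: C_def)
  \<comment> \<open>Maximum \<open>a\<close> and minimum \<open>- b\<close> of \<open>\<psi>\<close>
    are fixed by \<open>D + C + a = s\<close> and \<open>D - C - b = r\<close>.\<close>
  define a where "a = s - D - C"
  define b where "b = D - C - r"
  have ab: "a > 0" "b > 0" using C by (auto simp: a_def b_def M_def)
  obtain F \<psi> E p q where \<psi>: "continuous_on UNIV \<psi>" and F: "\<And>x. (F has_real_derivative \<psi> x) (at x)"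
    and per: "\<And>x. \<psi> (x + 2 * pi) = \<psi> x" "\<And>x. F (x + 2 * pi) = F x" and FE: "\<And>x. \<bar>F x\<bar> \<le> E"
    and \<psi>a: "\<And>x. \<psi> x \<le> a" and \<psi>b: "\<And>x. - b \<le> \<psi> x" and \<psi>p: "\<psi> p = a" and \<psi>q: "\<psi> q = - b"
    using periodic_zero_mean_with_range[OF ab] by metis
  define f where "f = (\<lambda>\<tau>. (C * sin (m * ln (\<tau> + 1)) + D) + \<psi> \<tau>)"
  define \<phi> where "\<phi> = (\<lambda>x :: real ^ 'n. f (norm x))"

  \<comment> \<open>Regularity and exact oscillation of the initial datum\<close>
  have \<psi>abs: "\<bar>\<psi> x\<bar> \<le> a + b" for x using \<psi>a[of x] \<psi>b[of x] ab by linarith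
  have \<psi>m [measurable]: "\<psi> \<in> borel_measurable borel"
    using \<psi> by (rule borel_measurable_continuous_onI)
  have fm: "f \<in> borel_measurable borel" unfolding f_def by measurable
  have Cs: "C * sin x \<le> C" "- C \<le> C * sin x" for x
    using mult_left_mono[of "sin x" 1 C] mult_left_mono[of "-1" "sin x" C] C by simp_all
  have fs: "f x \<le> s" "r \<le> f x" for x
    using Cs[of "m * ln (x + 1)"] \<psi>a[of x] \<psi>b[of x] unfolding f_def a_def b_def by linarith+
  have cont: "continuous_on UNIV \<phi>"
  proof -
    have "norm x + 1 \<noteq> 0" for x :: "real ^ 'n" using norm_ge_zero[of x] by linarith
    then show ?thesis unfolding \<phi>_def f_def
      by (intro continuous_intros continuous_on_compose2[OF \<psi>]) auto
  qed
  have bdd: "bounded (range \<phi>)"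
  proof (rule boundedI[of _ "\<bar>r\<bar> + \<bar>s\<bar>"])
    show "norm y \<le> \<bar>r\<bar> + \<bar>s\<bar>" if "y \<in> range \<phi>" for y
      using that fs unfolding \<phi>_def by (auto simp: abs_le_iff) (smt (verit))+
  qed
  have sup: "Limsup at_top (\<lambda>\<tau>. ereal (f \<tau>)) = ereal s"
  proof -
    obtain Y where Y: "filterlim Y at_top sequentially" "(\<lambda>j. C * sin (m * ln (Y j + 1)) + D + \<psi> (Y j)) \<longlonglongrightarrow> C * sin (pi / 2) + D + \<psi> p"
      using ln_phase_periodic_sequence[where \<psi> = \<psi>, OF m per(1)] by blast
    show ?thesis
    proof (rule Limsup_at_top_eqI[OF _ Y(1)])
      show "eventually (\<lambda>x. f x < s + e) at_top" if "e > 0" for e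
        using fs(1) that by (intro always_eventually allI) (smt (verit))
      show "(\<lambda>j. f (Y j)) \<longlonglongrightarrow> s" using Y(2) by (simp add: f_def \<psi>p a_def)
    qed
  qed
  have inf: "Liminf at_top (\<lambda>\<tau>. ereal (f \<tau>)) = ereal r"
  proof -
    obtain Y where Y: "filterlim Y at_top sequentially" "(\<lambda>j. C * sin (m * ln (Y j + 1)) + D + \<psi> (Y j)) \<longlonglongrightarrow> C * sin (- (pi / 2)) + D + \<psi> q"
      using ln_phase_periodic_sequence[where \<psi> = \<psi>, OF m per(1)] by blast
    show ?thesis
    proof (rule Liminf_at_top_eqI[OF _ Y(1)])
      show "eventually (\<lambda>x. r - e < f x) at_top" if "e > 0" for e
        using fs(2) that by (intro always_eventually allI) (smt (verit))
      show "(\<lambda>j. f (Y j)) \<longlonglongrightarrow> r" using Y(2) by (simp add: f_def \<psi>q b_def)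
    qed
  qed
  have int: "integral {0..2 * pi} \<psi> = 0"
  proof -
    have "(\<psi> has_integral (F (2 * pi) - F 0)) {0..2 * pi}"
      by (rule fundamental_theorem_of_calculus)
         (auto simp: has_real_derivative_iff_has_vector_derivative[symmetric] intro: has_field_derivative_at_within F)
    then show ?thesis using per(2)[of 0] by (simp add: integral_unique)
  qed

  \<comment> \<open>Long-time behaviour of the solution at the origin\<close>
  have lim: "((\<lambda>t. heat_convolution \<phi> 0 t - (D + d * sin (m * ln (2 * sqrt t) + \<delta>))) \<longlongrightarrow> 0) at_top"
  proof -
    let ?S = "\<lambda>R. LINT x|lborel. ?w x * sin (m * ln (R * x + 1))"
    let ?P = "\<lambda>R. LINT x|lborel. ?w x * \<psi> (R * x)"
    \<comment> \<open>The total error at \<open>R = 2 * sqrt t\<close>: the logarithmic part minus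
      its limiting sine, plus the averaged periodic part. The constant \<open>D\<close> is
      reproduced exactly because the density has mass 1.\<close>
    let ?g = "\<lambda>R. C * (?S R - (A * sin (m * ln R) + B * cos (m * ln R))) + ?P R"
    have "(?g \<longlongrightarrow> C * 0 + 0) at_top"
      unfolding A_def B_def
      by (intro tendsto_intros integral_radial_gauss_density_sin_ln[OF n]
          integral_radial_gauss_density_oscillation_tendsto_0[OF n F \<psi> \<psi>abs FE])
    then have "(?g \<longlongrightarrow> 0) at_top" by simp
    moreover have "filterlim (\<lambda>t. 2 * sqrt t) at_top at_top" by real_asymp
    ultimately have "((\<lambda>t. ?g (2 * sqrt t)) \<longlongrightarrow> 0) at_top" by (rule filterlim_compose)
    moreover have "eventually (\<lambda>t. ?g (2 * sqrt t) = heat_convolution \<phi> 0 t - (D + d * sin (m * ln (2 * sqrt t) + \<delta>))) at_top"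
      using eventually_gt_at_top[of 0]
    proof eventually_elim
      case (elim t)
      define R where "R = 2 * sqrt t"
      have i: "integrable lborel (\<lambda>x. ?w x * sin (m * ln (R * x + 1)))" "integrable lborel ?w"
        by (rule integrable_radial_gauss_density_mult[OF n, where B = 1]; (measurable; fail | simp))
           (rule integrable_radial_gauss_density[OF n])
      have iP: "integrable lborel (\<lambda>x. ?w x * \<psi> (R * x))"
        by (rule integrable_radial_gauss_density_mult[OF n _ \<psi>abs]) measurable
      have "heat_convolution \<phi> 0 t = (LINT x|lborel. ?w x * f (R * x))"
        unfolding \<phi>_def R_def by (rule heat_convolution_radial[OF fm elim])
      also have "(\<lambda>x. ?w x * f (R * x)) = (\<lambda>x. C * (?w x * sin (m * ln (R * x + 1))) + D * ?w x + ?w x * \<psi> (R * x))"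
        by (simp add: f_def fun_eq_iff algebra_simps)
      also have "(LINT x|lborel. C * (?w x * sin (m * ln (R * x + 1))) + D * ?w x + ?w x * \<psi> (R * x)) = C * ?S R + D + ?P R"
        using i iP integral_radial_gauss_density[OF n]
        by (simp add: Bochner_Integration.integral_add)
      finally have "heat_convolution \<phi> 0 t = C * ?S R + D + ?P R" .
      moreover have "d * sin (m * ln R + \<delta>) = C * (A * sin (m * ln R) + B * cos (m * ln R))"
        unfolding C\<rho>[symmetric] \<delta> by (simp add: sin_add algebra_simps)
      ultimately show ?case unfolding R_def[symmetric] by (simp add: right_diff_distrib)
    qed
    ultimately show ?thesis by (rule Lim_transform_eventually)
  qed
  have "D + d = \<beta>" "D - d = \<alpha>" by (simp_all add: D_def d_def field_simps)
  then have u: "Limsup at_top (\<lambda>t. ereal (heat_convolution \<phi> 0 t)) = ereal \<beta>"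
    "Liminf at_top (\<lambda>t. ereal (heat_convolution \<phi> 0 t)) = ereal \<alpha>"
    using Limsup_Liminf_log_oscillation[OF m _ lim] d by simp_all
  show ?thesis
  proof (rule exI[of _ \<phi>], rule exI[of _ f], intro conjI cont bdd inf u sup)
    show "\<forall>x. \<phi> x = f (norm x)" by (simp add: \<phi>_def)
    have "\<psi> p \<noteq> 0" using \<psi>p ab by simp
    then have "\<exists>\<tau>. \<psi> \<tau> \<noteq> 0" ..
    moreover have "\<forall>\<tau>\<ge>0. f \<tau> = (C * sin (m * ln (\<tau> + 1)) + D) + \<psi> \<tau>" by (simp add: f_def)
    ultimately show "\<exists>m C\<^sub>1 C\<^sub>2 \<psi>. m > 0 \<and> C\<^sub>1 > 0 \<and>
      continuous_on UNIV \<psi> \<and> (\<forall>\<tau>. \<psi> (\<tau> + 2 * pi) = \<psi> \<tau>) \<and> (\<exists>\<tau>. \<psi> \<tau> \<noteq> 0) \<and>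
      1 / (2 * pi) * integral {0..2 * pi} \<psi> = 0 \<and>
      (\<forall>\<tau>\<ge>0. f \<tau> = (C\<^sub>1 * sin (m * ln (\<tau> + 1)) + C\<^sub>2) + \<psi> \<tau>)"
      using m C(1) \<psi> per(1) int
      by (rule_tac exI[of _ m], rule_tac exI[of _ C], rule_tac exI[of _ D], rule_tac exI[of _ \<psi>]) simp
  qed
qed

end
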